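(* There exist a universal constant $c>0$ and a function $D:(2,\infty)\to(0,\infty)$ such that for every $n\in\mathbb{N}$ and every $2<q<\infty$ there exists a bipartite quantum probability distribution $P$ with $[n^{q/2}]^n$ inputs per site, $n+1$ outputs per site, and Hilbert spaces $H_1,H_2$ of dimension $n$ each, such that $$\nu(P)\ \ge\ c\,D(q)\,n^{\frac12-\frac2q}.$$
   Context: For a real number $x$, $[x]$ denotes the smallest natural number $p$ with $x\le p$. Fix $N$ (number of inputs per site) and $K$ (number of outputs per site). Consider families $P=(P(a,b|x,y))$, $x,y\in\{1,\dots,N\}$, $a,b\in\{1,\dots,K\}$. $P$ is classical ($P\in\mathcal{L}$) if $P(a,b|x,y)=\int_\Omega P_\omega(a|x)Q_\omega(b|y)\,d\mathbb{P}(\omega)$ for all $x,y,a,b$, where $(\Omega,\mathbb{P})$ is a probability space, $P_\omega(a|x)\ge0$, $\sum_aP_\omega(a|x)=1$ for all $x,\omega$, and analogously for $Q_\omega(b|y)$. $P$ is quantum ($P\in\mathcal{Q}$), with Hilbert spaces $H_1,H_2$, if $P(a,b|x,y)=\mathrm{tr}\big((E_x^a\otimes F_y^b)\rho\big)$ for all $x,y,a,b$, where $\rho$ is a density operator on $H_1\otimes H_2$, $E_x^a\in B(H_1)$ and $F_y^b\in B(H_2)$ are positive semidefinite operators, $\sum_aE_x^a=\mathbb{1}$ for every $x$ and $\sum_bF_y^b=\mathbb{1}$ for every $y$. For a real family $M=(M_{x,y}^{a,b})$ put $\langle M,P\rangle=\sum_{x,y,a,b}M_{x,y}^{a,b}P(a,b|x,y)$,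 and define the largest Bell violation $$\nu(P)=\sup\{\langle M,P\rangle:\ |\langle M,P'\rangle|\le1\ \text{for every }P'\in\mathcal{L}\},$$ where $\mathcal{L}$ is taken with the same numbers of inputs and outputs as $P$. *)

theory Defs
  imports "HOL-Probability.Probability" "Jordan_Normal_Form.Matrix"
begin

text \<open>
  A family \<open>P(a,b|x,y)\<close> is a function applied as \<open>P a b x y\<close>.  Inputs range over \<open>{..<N}\<close> and
  outputs over \<open>{..<K}\<close>; values at other arguments are irrelevant.
\<close>

type_synonym bell_family = "nat \<Rightarrow> nat \<Rightarrow> nat \<Rightarrow> nat \<Rightarrow> real"


subsection \<open>Classical families\<close>

definition response :: "'w measure \<Rightarrow> nat \<Rightarrow> nat \<Rightarrow> (nat \<Rightarrow> nat \<Rightarrow> 'w \<Rightarrow> real) \<Rightarrow> bool" where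
  "response \<Omega> N K p \<longleftrightarrow>
     (\<forall>x<N. \<forall>a<K. p a x \<in> borel_measurable \<Omega>) \<and>
     (\<forall>x<N. \<forall>\<omega>\<in>space \<Omega>. (\<forall>a<K. 0 \<le> p a x \<omega>) \<and> (\<Sum>a<K. p a x \<omega>) = 1)"

definition classical_over :: "'w measure \<Rightarrow> nat \<Rightarrow> nat \<Rightarrow> bell_family \<Rightarrow> bool" where
  "classical_over \<Omega> N K P \<longleftrightarrow>
     prob_space \<Omega> \<and>
     (\<exists>p q. response \<Omega> N K p \<and> response \<Omega> N K q \<and>
        (\<forall>x<N. \<forall>y<N. \<forall>a<K. \<forall>b<K. P a b x y = (\<integral>\<omega>. p a x \<omega> * q b y \<omega> \<partial>\<Omega>)))"

text \<open>
  HOL cannot quantify over the type of sample points inside a definition, so it is fixed to be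
  \<open>nat \<Rightarrow> real\<close>; the sigma-algebra and the underlying set remain arbitrary.  The lemma
  \<open>classical_over_imp_classical\<close> below shows that no classical family is lost.
\<close>

definition classical :: "nat \<Rightarrow> nat \<Rightarrow> bell_family set" where
  "classical N K = {P. \<exists>\<Omega> :: (nat \<Rightarrow> real) measure. classical_over \<Omega> N K P}"

lemma classical_over_imp_classical:
  fixes \<Omega> :: "'w measure"
  assumes "classical_over \<Omega> N K P"
  shows "P \<in> classical N K"
proof -
  obtain p q where pr: "prob_space \<Omega>" and p: "response \<Omega> N K p" and q: "response \<Omega> N K q"
    and P: "\<And>x y a b. x < N \<Longrightarrow> y < N \<Longrightarrow> a < K \<Longrightarrow> b < K \<Longrightarrow>
              P a b x y = (\<integral>\<omega>. p a x \<omega> * q b y \<omega> \<partial>\<Omega>)"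
    using assms unfolding classical_over_def by blast
  interpret prob_space \<Omega> by (rule pr)
  define ext where "ext f k \<omega> =
      (let (a, x) = prod_decode k in if a < K \<and> x < N then f a x \<omega> else 0)"
    for f :: "nat \<Rightarrow> nat \<Rightarrow> 'w \<Rightarrow> real" and k \<omega>
  define g where "g \<omega> k =
      (case sum_decode k of Inl i \<Rightarrow> ext p i \<omega> | Inr i \<Rightarrow> ext q i \<omega>)" for \<omega> k
  define p' :: "nat \<Rightarrow> nat \<Rightarrow> (nat \<Rightarrow> real) \<Rightarrow> real" where
    "p' a x s = s (sum_encode (Inl (prod_encode (a, x))))" for a x s
  define q' :: "nat \<Rightarrow> nat \<Rightarrow> (nat \<Rightarrow> real) \<Rightarrow> real" where
    "q' a x s = s (sum_encode (Inr (prod_encode (a, x))))" for a x s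
  define S where "S = restrict_space (\<Pi>\<^sub>M k\<in>(UNIV :: nat set). (borel :: real measure)) (g ` space \<Omega>)"
  define \<Omega>' where "\<Omega>' = distr \<Omega> S g"
  have p'g: "p' a x (g \<omega>) = p a x \<omega>" and q'g: "q' a x (g \<omega>) = q a x \<omega>"
    if "a < K" "x < N" for a x \<omega>
    using that by (auto simp: p'_def q'_def g_def ext_def)
  have ext_meas: "ext f k \<in> borel_measurable \<Omega>" if "response \<Omega> N K f" for f k
  proof -
    obtain a x where k: "prod_decode k = (a, x)" by (cases "prod_decode k")
    show ?thesis
      using that by (cases "a < K \<and> x < N") (auto simp: ext_def[abs_def] k response_def)
  qed
  have "(\<lambda>\<omega>. g \<omega> k) \<in> borel_measurable \<Omega>" for k
    using ext_meas[OF p] ext_meas[OF q] by (cases "sum_decode k") (auto simp: g_def)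
  then have "g \<in> measurable \<Omega> (\<Pi>\<^sub>M k\<in>(UNIV :: nat set). (borel :: real measure))"
    by (intro measurable_PiM_single') (auto simp: PiE_def extensional_def)
  then have g: "g \<in> measurable \<Omega> S"
    unfolding S_def by (intro measurable_restrict_space2) auto
  have spS: "space S = g ` space \<Omega>"
    by (auto simp: S_def space_restrict_space space_PiM PiE_def extensional_def)
  have meas: "(\<lambda>s. s k) \<in> borel_measurable S" for k
    unfolding S_def by (intro measurable_restrict_space1 measurable_component_singleton) auto
  have p'm: "p' a x \<in> borel_measurable S" and q'm: "q' a x \<in> borel_measurable S" for a x
    using meas by (simp_all add: p'_def[abs_def] q'_def[abs_def])
  have rp: "response \<Omega>' N K p'"
    using p p'm by (auto simp: response_def \<Omega>'_def spS p'g)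
  have rq: "response \<Omega>' N K q'"
    using q q'm by (auto simp: response_def \<Omega>'_def spS q'g)
  have "P a b x y = (\<integral>s. p' a x s * q' b y s \<partial>\<Omega>')"
    if "x < N" "y < N" "a < K" "b < K" for x y a b
  proof -
    have "(\<integral>s. p' a x s * q' b y s \<partial>\<Omega>') = (\<integral>\<omega>. p' a x (g \<omega>) * q' b y (g \<omega>) \<partial>\<Omega>)"
      unfolding \<Omega>'_def by (rule integral_distr[OF g]) (intro borel_measurable_times p'm q'm)
    then show ?thesis using that by (simp add: p'g q'g P)
  qed
  moreover have "prob_space \<Omega>'"
    unfolding \<Omega>'_def by (rule prob_space_distr[OF g])
  ultimately have "classical_over \<Omega>' N K P"
    unfolding classical_over_def using rp rq by blast
  then show ?thesis unfolding classical_def by blast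
qed


subsection \<open>Quantum families\<close>

text \<open>
  A Hilbert space of dimension \<open>d\<close> is taken to be \<open>\<complex>\<^sup>d\<close>, its operators being the complex
  \<open>d \<times> d\<close> matrices.  In \<open>psd\<close>, \<open>0 \<le> z\<close> for complex \<open>z\<close> means that \<open>z\<close> is real and nonnegative.
\<close>

definition psd :: "nat \<Rightarrow> complex mat \<Rightarrow> bool" where
  "psd d A \<longleftrightarrow> A \<in> carrier_mat d d \<and> (\<forall>v\<in>carrier_vec d. 0 \<le> (A *\<^sub>v v) \<bullet>c v)"

definition mtrace :: "complex mat \<Rightarrow> complex" where
  "mtrace A = (\<Sum>i<dim_row A. A $$ (i, i))"

definition density_operator :: "nat \<Rightarrow> complex mat \<Rightarrow> bool" where
  "density_operator d \<rho> \<longleftrightarrow> psd d \<rho> \<and> mtrace \<rho> = 1"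

text \<open>
  The Kronecker product: \<open>e\<^sub>i \<otimes> e\<^sub>j\<close> is the basis vector number \<open>i * d\<^sub>2 + j\<close> of
  \<open>\<complex>\<^bsup>d\<^sub>1 * d\<^sub>2\<^esup> = \<complex>\<^bsup>d\<^sub>1\<^esup> \<otimes> \<complex>\<^bsup>d\<^sub>2\<^esup>\<close>.
\<close>

definition tensor_mat :: "complex mat \<Rightarrow> complex mat \<Rightarrow> complex mat" where
  "tensor_mat A B = mat (dim_row A * dim_row B) (dim_col A * dim_col B)
     (\<lambda>(i, j). A $$ (i div dim_row B, j div dim_col B) * B $$ (i mod dim_row B, j mod dim_col B))"

definition povm :: "nat \<Rightarrow> nat \<Rightarrow> (nat \<Rightarrow> complex mat) \<Rightarrow> bool" where
  "povm d K E \<longleftrightarrow>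
     (\<forall>a<K. psd d (E a)) \<and>
     mat d d (\<lambda>(i, j). \<Sum>a<K. E a $$ (i, j)) = 1\<^sub>m d"

definition quantum :: "nat \<Rightarrow> nat \<Rightarrow> nat \<Rightarrow> nat \<Rightarrow> bell_family set" where
  "quantum d1 d2 N K = {P. \<exists>\<rho> E F.
     density_operator (d1 * d2) \<rho> \<and>
     (\<forall>x<N. povm d1 K (E x)) \<and> (\<forall>y<N. povm d2 K (F y)) \<and>
     (\<forall>x<N. \<forall>y<N. \<forall>a<K. \<forall>b<K.
        complex_of_real (P a b x y) = mtrace (tensor_mat (E x a) (F y b) * \<rho>))}"


subsection \<open>Bell violations\<close>

definition bell_pairing :: "nat \<Rightarrow> nat \<Rightarrow> bell_family \<Rightarrow> bell_family \<Rightarrow> real" where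
  "bell_pairing N K M P = (\<Sum>x<N. \<Sum>y<N. \<Sum>a<K. \<Sum>b<K. M a b x y * P a b x y)"

definition largest_violation :: "nat \<Rightarrow> nat \<Rightarrow> bell_family \<Rightarrow> ereal" where
  "largest_violation N K P =
     (SUP M \<in> {M. \<forall>P'\<in>classical N K. \<bar>bell_pairing N K M P'\<bar> \<le> 1}. ereal (bell_pairing N K M P))"

end

theory Submission
  imports Defs
begin

text \<open>
  The violation comes from a variant of the Khot-Vishnoi game with noise of correlation \<open>1/3\<close>.
  Let \<open>m\<close> be the largest power of two with \<open>m \<le> n\<close>, and let \<open>h\<^sub>a\<close> be the rows of a Hadamard matrix of
  order \<open>m\<close>.  Inputs are the \<open>2\<^sup>m\<close> sign vectors, and the Bell functional gives \<open>(a, b)\<close> on inputs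
  \<open>(x, y)\<close> the weight \<open>\<Prod>\<^sub>i (1 + s\<^sub>i t\<^sub>i / 3)\<close>, where \<open>s = x h\<^sub>a\<close> and \<open>t = y h\<^sub>b\<close>.  Measuring a maximally
  entangled state in the bases \<open>(x h\<^sub>a / \<surd>m)\<^sub>a\<close> and \<open>(y h\<^sub>b / \<surd>m)\<^sub>b\<close> gives outcomes with probability
  \<open>(\<Sum>\<^sub>i s\<^sub>i t\<^sub>i)\<^sup>2 / m\<^sup>3\<close>, so that the value is at least \<open>4\<^sup>m m / 9\<close>, because \<open>s\<^sub>i t\<^sub>i\<close> has mean \<open>1/3\<close> under
  the weight.

  A pair of classical strategies yields functions \<open>A(s) = (1/m) \<Sum>\<^sub>a p(a|s h\<^sub>a)\<close> and \<open>B\<close> on the cube with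
  values in \<open>[0, 1]\<close> and mean at most \<open>1/m\<close>.  Hypercontractivity of the noise operator from \<open>L\<^bsup>4/3\<^esup>\<close> to
  \<open>L\<^sup>4\<close> bounds the value by \<open>4\<^sup>m m\<^sup>2 (1/m)\<^bsup>3/2\<^esup> = 4\<^sup>m \<surd>m\<close>.  The violation is thus at least \<open>\<surd>m / 9\<close>, which
  exceeds \<open>n\<^bsup>1/2 - 2/q\<^esup> / 18\<close>.  For \<open>n = 1\<close> there is only one input, hence no room for the \<open>2\<^sup>m\<close> sign
  vectors, but the trivial violation suffices.
\<close>

subsection \<open>Hypercontractivity on the discrete cube\<close>

definition cube :: "'i set \<Rightarrow> ('i \<Rightarrow> real) set" where
  "cube I = (\<Pi>\<^sub>E i\<in>I. {-1, 1})"

text \<open>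
  With respect to the uniform measure on the square of the cube, \<open>kern\<close> is the density of a pair
  of uniform sign vectors whose coordinates have correlation \<open>1/3\<close>.
\<close>

definition kern :: "'i set \<Rightarrow> ('i \<Rightarrow> real) \<Rightarrow> ('i \<Rightarrow> real) \<Rightarrow> real" where
  "kern I s t = (\<Prod>i\<in>I. 1 + s i * t i / 3)"

lemma finite_cube: "finite I \<Longrightarrow> finite (cube I)"
  by (simp add: cube_def finite_PiE)

lemma card_cube: "finite I \<Longrightarrow> card (cube I) = 2 ^ card I"
  by (simp add: cube_def card_PiE numeral_2_eq_2)

lemma cube_cases: "s \<in> cube I \<Longrightarrow> i \<in> I \<Longrightarrow> s i = -1 \<or> s i = 1"
  by (auto simp: cube_def PiE_def Pi_def)

lemma kern_nonneg: "s \<in> cube I \<Longrightarrow> t \<in> cube I \<Longrightarrow> 0 \<le> kern I s t"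
  unfolding kern_def
proof (rule prod_nonneg)
  fix i assume "s \<in> cube I" "t \<in> cube I" "i \<in> I"
  then show "0 \<le> 1 + s i * t i / 3"
    using cube_cases[of s I i] cube_cases[of t I i] by auto
qed

lemma sum_cube_insert:
  assumes "finite I" "i \<notin> I"
  shows "(\<Sum>s\<in>cube (insert i I). f s) = (\<Sum>s\<in>cube I. f (s(i := -1)) + f (s(i := 1)))"
proof -
  have "cube (insert i I) = (\<lambda>(y, g). g(i := y)) ` ({-1, 1} \<times> cube I)"
    unfolding cube_def by (rule PiE_insert_eq)
  moreover have "inj_on (\<lambda>(y, g). g(i := y)) ({-1, 1} \<times> cube I)"
    unfolding cube_def using inj_combinator[OF assms(2), of "\<lambda>_. {-1, 1 :: real}"] by simp
  ultimately have "sum f (cube (insert i I)) = (\<Sum>(y, g)\<in>{-1, 1} \<times> cube I. f (g(i := y)))"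
    by (simp add: sum.reindex case_prod_unfold)
  also have "\<dots> = (\<Sum>y\<in>{-1, 1}. \<Sum>g\<in>cube I. f (g(i := y)))"
    by (simp add: sum.cartesian_product)
  finally show ?thesis by (simp add: sum.distrib)
qed

lemma kern_insert:
  assumes "finite I" "i \<notin> I"
  shows "kern (insert i I) (s(i := a)) (t(i := b)) = (1 + a * b / 3) * kern I s t"
proof -
  have "(\<Prod>j\<in>I. 1 + (s(i := a)) j * (t(i := b)) j / 3) = kern I s t"
    unfolding kern_def using assms by (intro prod.cong) auto
  then show ?thesis using assms by (simp add: kern_def)
qed

text \<open>The diagonal case of the two-point inequality: squaring turns it into a polynomial
  inequality whose difference has the factor \<open>(x - y) ^ 4\<close> and a nonnegative
  cofactor.\<close>

lemma two_point_diagonal: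
  fixes x y :: real
  assumes "0 \<le> x" "0 \<le> y" "0 \<le> u" "u ^ 4 = (x ^ 4 + y ^ 4) / 2"
  shows "(x ^ 6 + x ^ 3 * y ^ 3 + y ^ 6) / 3 \<le> u ^ 6"
proof -
  have "9 * (x ^ 4 + y ^ 4) ^ 3 - 8 * (x ^ 6 + x ^ 3 * y ^ 3 + y ^ 6)\<^sup>2 =
    (x - y) ^ 4 * (x ^ 8 + 4 * x ^ 7 * y + 9 * x ^ 6 * y\<^sup>2 + 4 * x ^ 5 * y ^ 3
      + 4 * x ^ 3 * y ^ 5 + 9 * x\<^sup>2 * y ^ 6 + 4 * x * y ^ 7 + y ^ 8 + (x ^ 3 * y - x * y ^ 3)\<^sup>2)"
  proof -
    have 1: "(x - y) ^ 4 = x ^ 4 - 4 * x ^ 3 * y + 6 * x^2 * y^2 - 4 * x * y ^ 3 + y ^ 4"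
      by (simp add: eval_nat_numeral algebra_simps)
    have 2: "(x ^ 4 + y ^ 4) ^ 3 = x ^ 12 + 3 * x ^ 8 * y ^ 4 + 3 * x ^ 4 * y ^ 8 + y ^ 12"
      by (simp add: power3_eq_cube algebra_simps flip: power_add)
    have 3: "(x ^ 6 + x ^ 3 * y ^ 3 + y ^ 6)\<^sup>2 = x ^ 12 + 2 * x ^ 9 * y ^ 3 + 3 * x ^ 6 * y ^ 6 + 2 * x ^ 3 * y ^ 9 + y ^ 12"
      by (simp add: power2_eq_square algebra_simps flip: power_add)
    have 4: "(x ^ 3 * y - x * y ^ 3)\<^sup>2 = x ^ 6 * y ^ 2 - 2 * x ^ 4 * y ^ 4 + x ^ 2 * y ^ 6"
      by (simp add: eval_nat_numeral algebra_simps)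
    show ?thesis unfolding 1 2 3 4
      by (simp add: algebra_simps power_numeral_reduce)
  qed
  also have "\<dots> \<ge> 0" using assms by (intro mult_nonneg_nonneg add_nonneg_nonneg) auto
  finally have "((x ^ 6 + x ^ 3 * y ^ 3 + y ^ 6) / 3)\<^sup>2 \<le> (u ^ 4) ^ 3"
    unfolding assms by (simp add: power_divide field_simps)
  also have "\<dots> = (u ^ 6)\<^sup>2" by (simp flip: power_mult)
  finally show ?thesis by (rule power2_le_imp_le) (use assms in simp)
qed

text \<open>The weights are those of \<open>kern\<close> for equal and opposite signs. They form a
  positive definite bilinear form, so Cauchy-Schwarz reduces the claim to the diagonal case.\<close>

lemma two_point:
  fixes x y x' y' u v :: real
  assumes "0 \<le> x" "0 \<le> y" "0 \<le> x'" "0 \<le> y'" "0 \<le> u" "0 \<le> v"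
    and u: "u ^ 4 = (x ^ 4 + y ^ 4) / 2" and v: "v ^ 4 = (x' ^ 4 + y' ^ 4) / 2"
  shows "4 / 3 * (x ^ 3 * x' ^ 3) + 2 / 3 * (x ^ 3 * y' ^ 3) + 2 / 3 * (y ^ 3 * x' ^ 3)
    + 4 / 3 * (y ^ 3 * y' ^ 3) \<le> 4 * (u ^ 3 * v ^ 3)"
proof -
  define B where "B a b c d = (a * c + b * d) / 3 + (a * d + b * c) / 6" for a b c d :: real
  have "B a b a b * B c d c d - (B a b c d)\<^sup>2 = (a * d - b * c)\<^sup>2 / 12" for a b c d
    unfolding B_def by (simp add: field_simps power2_eq_square)
  then have CS: "(B a b c d)\<^sup>2 \<le> B a b a b * B c d c d" for a b c d
    by (smt (verit) divide_nonneg_nonneg zero_le_power2)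
  have 1: "B (x ^ 3) (y ^ 3) (x ^ 3) (y ^ 3) \<le> u ^ 6"
    using two_point_diagonal[OF assms(1,2,5) u] by (simp add: B_def field_simps flip: power_add)
  have 2: "B (x' ^ 3) (y' ^ 3) (x' ^ 3) (y' ^ 3) \<le> v ^ 6"
    using two_point_diagonal[OF assms(3,4,6) v] by (simp add: B_def field_simps flip: power_add)
  have "(B (x ^ 3) (y ^ 3) (x' ^ 3) (y' ^ 3))\<^sup>2 \<le> u ^ 6 * v ^ 6"
    by (rule order_trans[OF CS mult_mono[OF 1 2]]) (use assms in \<open>auto simp: B_def\<close>)
  also have "\<dots> = (u ^ 3 * v ^ 3)\<^sup>2" by (simp add: power_mult_distrib flip: power_mult)
  finally have "B (x ^ 3) (y ^ 3) (x' ^ 3) (y' ^ 3) \<le> u ^ 3 * v ^ 3"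
    by (rule power2_le_imp_le) (use assms in simp)
  then show ?thesis by (simp add: B_def field_simps)
qed

text \<open>
  Substituting \<open>X\<^sup>3\<close> and \<open>Y\<^sup>3\<close> for the two functions avoids fractional exponents: \<open>u\<^sup>3\<close> and \<open>v\<^sup>3\<close>
  are their norms in \<open>L\<^bsup>4/3\<^esup>\<close>.  The induction step is the two-point inequality applied to the
  norms of the restrictions to the two halves of the cube.
\<close>

lemma hypercontractivity:
  fixes X Y :: "('i \<Rightarrow> real) \<Rightarrow> real" and u v :: real
  assumes "finite I" "\<And>s. 0 \<le> X s" "\<And>s. 0 \<le> Y s" "0 \<le> u" "0 \<le> v"
    "u ^ 4 = (\<Sum>s\<in>cube I. X s ^ 4) / 2 ^ card I" "v ^ 4 = (\<Sum>s\<in>cube I. Y s ^ 4) / 2 ^ card I"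
  shows "(\<Sum>s\<in>cube I. \<Sum>t\<in>cube I. kern I s t * X s ^ 3 * Y t ^ 3) \<le> 4 ^ card I * (u ^ 3 * v ^ 3)"
  using assms
proof (induction I arbitrary: X Y u v rule: finite_induct)
  case empty
  \<comment> \<open>The cube over the empty set has a single point, which is constantly
    \<open>undefined\<close>.\<close>
  have "u ^ 4 = X (\<lambda>_. undefined) ^ 4" "v ^ 4 = Y (\<lambda>_. undefined) ^ 4"
    using empty by (simp_all add: cube_def)
  then have "u = X (\<lambda>_. undefined)" "v = Y (\<lambda>_. undefined)"
    using empty power_eq_imp_eq_base[of u 4] power_eq_imp_eq_base[of v 4] by auto
  then show ?case by (simp add: cube_def kern_def)
next
  case (insert i I)
  define r where "r Z = root 4 ((\<Sum>s\<in>cube I. Z s ^ 4) / 2 ^ card I)"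
    for Z :: "('i \<Rightarrow> real) \<Rightarrow> real"
  have sum_nonneg4: "0 \<le> (\<Sum>s\<in>cube I. Z s ^ 4) / 2 ^ card I" for Z :: "('i \<Rightarrow> real) \<Rightarrow> real"
    by (intro divide_nonneg_pos sum_nonneg) auto
  have r: "0 \<le> r Z" "r Z ^ 4 = (\<Sum>s\<in>cube I. Z s ^ 4) / 2 ^ card I" for Z
    using sum_nonneg4[of Z] by (simp_all add: r_def)
  define X0 X1 Y0 Y1 where defs:
    "X0 s = X (s(i := -1))" "X1 s = X (s(i := 1))" "Y0 s = Y (s(i := -1))" "Y1 s = Y (s(i := 1))"
    for s
  let ?S = "\<lambda>X Y. \<Sum>s\<in>cube I. \<Sum>t\<in>cube I. kern I s t * X s ^ 3 * Y t ^ 3"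
  have IH: "?S X' Y' \<le> 4 ^ card I * (r X' ^ 3 * r Y' ^ 3)"
    if "X' \<in> {X0, X1}" "Y' \<in> {Y0, Y1}" for X' Y'
    using insert.IH[of X' Y' "r X'" "r Y'"] r that insert.prems by (auto simp: defs)
  have u: "u ^ 4 = (r X0 ^ 4 + r X1 ^ 4) / 2"
    using insert by (simp add: r(2) defs sum_cube_insert sum.distrib field_simps)
  have v: "v ^ 4 = (r Y0 ^ 4 + r Y1 ^ 4) / 2"
    using insert by (simp add: r(2) defs sum_cube_insert sum.distrib field_simps)
  have "(\<Sum>s\<in>cube (insert i I). \<Sum>t\<in>cube (insert i I). kern (insert i I) s t * X s ^ 3 * Y t ^ 3)
    = 4 / 3 * ?S X0 Y0 + 2 / 3 * ?S X0 Y1 + 2 / 3 * ?S X1 Y0 + 4 / 3 * ?S X1 Y1"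
    unfolding sum_cube_insert[OF insert.hyps] kern_insert[OF insert.hyps] defs[symmetric]
      sum_distrib_left sum.distrib[symmetric]
    by (intro sum.cong refl) (simp add: algebra_simps)
  also have "\<dots> \<le> 4 ^ card I * (4 / 3 * (r X0 ^ 3 * r Y0 ^ 3) + 2 / 3 * (r X0 ^ 3 * r Y1 ^ 3)
    + 2 / 3 * (r X1 ^ 3 * r Y0 ^ 3) + 4 / 3 * (r X1 ^ 3 * r Y1 ^ 3))"
    using IH[of X0 Y0] IH[of X0 Y1] IH[of X1 Y0] IH[of X1 Y1] by (simp add: algebra_simps)
  also have "\<dots> \<le> 4 ^ card I * (4 * (u ^ 3 * v ^ 3))"
    by (intro mult_left_mono two_point) (use r u v insert.prems in auto)
  finally show ?case using insert by simp
qed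

text \<open>Since \<open>A s\<close> lies in \<open>[0, 1]\<close>, its 4/3-power is at most
  \<open>A s\<close>. Each 4/3-norm is thus at most the 3/4-power of \<open>\<mu>\<close>, and
  \<open>\<mu> * sqrt \<mu>\<close> is the product of two such bounds.\<close>

lemma kern_sum_le:
  fixes A B :: "('i \<Rightarrow> real) \<Rightarrow> real"
  assumes I: "finite I" and A: "\<And>s. 0 \<le> A s" "\<And>s. A s \<le> 1" and B: "\<And>s. 0 \<le> B s" "\<And>s. B s \<le> 1"
    and \<mu>: "(\<Sum>s\<in>cube I. A s) \<le> \<mu> * 2 ^ card I" "(\<Sum>s\<in>cube I. B s) \<le> \<mu> * 2 ^ card I"
  shows "(\<Sum>s\<in>cube I. \<Sum>t\<in>cube I. kern I s t * A s * B t) \<le> 4 ^ card I * (\<mu> * sqrt \<mu>)"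
proof -
  define X where "X Z s = root 3 (Z s)" for Z :: "('i \<Rightarrow> real) \<Rightarrow> real" and s
  define u where "u Z = root 4 ((\<Sum>s\<in>cube I. X Z s ^ 4) / 2 ^ card I)" for Z
  have props: "(\<forall>s. 0 \<le> X Z s \<and> X Z s ^ 3 = Z s) \<and> 0 \<le> u Z \<and> u Z ^ 6 \<le> \<mu> * sqrt \<mu>
      \<and> u Z ^ 4 = (\<Sum>s\<in>cube I. X Z s ^ 4) / 2 ^ card I"
    if "\<And>s. 0 \<le> Z s" "\<And>s. Z s \<le> 1" "(\<Sum>s\<in>cube I. Z s) \<le> \<mu> * 2 ^ card I" for Z
  proof -
    have X: "0 \<le> X Z s" "X Z s \<le> 1" "X Z s ^ 3 = Z s" for s
      using that(1,2)[of s] by (auto simp: X_def)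
    have "X Z s ^ 4 \<le> Z s" for s
      using X[of s] power_decreasing[of 3 4 "X Z s"] by simp
    then have le: "(\<Sum>s\<in>cube I. X Z s ^ 4) \<le> \<mu> * 2 ^ card I"
      using that(3) by (meson order_trans sum_mono)
    have ge: "0 \<le> (\<Sum>s\<in>cube I. X Z s ^ 4)" by (intro sum_nonneg) auto
    have u: "0 \<le> u Z" "u Z ^ 4 = (\<Sum>s\<in>cube I. X Z s ^ 4) / 2 ^ card I"
      using ge by (auto simp: u_def)
    then have u4: "u Z ^ 4 \<le> \<mu>" using le by (simp add: divide_le_eq)
    then have \<mu>0: "0 \<le> \<mu>" using zero_le_power[OF u(1), of 4] by linarith
    have "(u Z ^ 6)\<^sup>2 = (u Z ^ 4) ^ 3" by (simp flip: power_mult)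
    also have "\<dots> \<le> \<mu> ^ 3" using u4 u(1) by (intro power_mono) auto
    also have "\<dots> = (\<mu> * sqrt \<mu>)\<^sup>2"
      using \<mu>0 by (simp add: power_mult_distrib) (simp add: power2_eq_square power3_eq_cube)
    finally have "u Z ^ 6 \<le> \<mu> * sqrt \<mu>" by (rule power2_le_imp_le) (use \<mu>0 in simp)
    then show ?thesis using X u by auto
  qed
  note pA = props[OF A \<mu>(1)] and pB = props[OF B \<mu>(2)]
  have "(\<Sum>s\<in>cube I. \<Sum>t\<in>cube I. kern I s t * X A s ^ 3 * X B t ^ 3) \<le> 4 ^ card I * (u A ^ 3 * u B ^ 3)"
    by (rule hypercontractivity[OF I]) (use pA pB in auto)
  also have "u A ^ 3 * u B ^ 3 \<le> \<mu> * sqrt \<mu>"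
  proof -
    have nonneg: "0 \<le> \<mu> * sqrt \<mu>"
      using pA zero_le_power[of "u A" 6] by linarith
    have "(u A ^ 3 * u B ^ 3)\<^sup>2 = u A ^ 6 * u B ^ 6"
      by (simp add: power_mult_distrib flip: power_mult)
    also have "\<dots> \<le> (\<mu> * sqrt \<mu>) * (\<mu> * sqrt \<mu>)"
      using pA pB nonneg by (intro mult_mono) auto
    finally have "(u A ^ 3 * u B ^ 3)\<^sup>2 \<le> (\<mu> * sqrt \<mu>)\<^sup>2" by (simp only: power2_eq_square)
    then show ?thesis using nonneg by (rule power2_le_imp_le)
  qed
  finally show ?thesis using pA pB by simp
qed

section \<open>Moments of the noise kernel\<close>

lemma sum_kern:
  assumes "finite I" "s \<in> cube I"
  shows "(\<Sum>t\<in>cube I. kern I s t) = 2 ^ card I"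
proof -
  have "(\<Sum>t\<in>cube I. kern I s t) = (\<Prod>i\<in>I. \<Sum>y\<in>{-1, 1}. 1 + s i * y / 3)"
    unfolding cube_def kern_def using assms(1) by (subst prod_sum_PiE) auto
  then show ?thesis by simp
qed

lemma sum_kern_coordinate:
  assumes "finite I" "s \<in> cube I" "j \<in> I"
  shows "(\<Sum>t\<in>cube I. kern I s t * (s j * t j)) = 2 ^ card I / 3"
proof -
  have sq: "s i * s i = 1" if "i \<in> I" for i using cube_cases[OF assms(2) that] by auto
  \<comment> \<open>The factor \<open>s j * t j\<close> is absorbed into coordinate
    \<open>j\<close>, so the sum over the cube factors over coordinates.\<close>
  let ?f = "\<lambda>i y. (1 + s i * y / 3) * (if i = j then s i * y else 1)"
  have "(\<Sum>t\<in>cube I. kern I s t * (s j * t j)) = (\<Sum>t\<in>cube I. \<Prod>i\<in>I. ?f i (t i))"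
    using assms by (intro sum.cong) (auto simp: kern_def prod.distrib prod.delta)
  also have "\<dots> = (\<Prod>i\<in>I. \<Sum>y\<in>{-1, 1}. ?f i y)"
    unfolding cube_def using assms(1) by (subst prod_sum_PiE) auto
  also have "\<dots> = (\<Prod>i\<in>I. if i = j then 2 * (1 / 3) else 2)"
    by (intro prod.cong) (auto simp: sq algebra_simps)
  also have "\<dots> = (\<Prod>i\<in>I. 2 * (if i = j then 1 / 3 else 1 :: real))"
    by (intro prod.cong) auto
  also have "\<dots> = 2 ^ card I / 3" using assms by (simp add: prod.distrib prod.delta)
  finally show ?thesis .
qed

text \<open>Jensen's inequality for the square, via its tangent at the mean
  \<open>card I / 3\<close> of the correlation.\<close>

lemma sum_kern_correlation_ge:
  assumes I: "finite I" and s: "s \<in> cube I"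
  shows "2 ^ card I * (real (card I))\<^sup>2 / 9 \<le> (\<Sum>t\<in>cube I. kern I s t * (\<Sum>i\<in>I. s i * t i)\<^sup>2)"
proof -
  define m where "m = real (card I) / 3"
  let ?Z = "\<lambda>t. \<Sum>i\<in>I. s i * t i"
  have Z: "(\<Sum>t\<in>cube I. kern I s t * ?Z t) = 2 ^ card I * m"
  proof -
    have "(\<Sum>t\<in>cube I. kern I s t * ?Z t) = (\<Sum>j\<in>I. \<Sum>t\<in>cube I. kern I s t * (s j * t j))"
      unfolding sum_distrib_left by (rule sum.swap)
    then show ?thesis using sum_kern_coordinate[OF I s] by (simp add: m_def)
  qed
  have "kern I s t * (2 * m * ?Z t - m\<^sup>2) \<le> kern I s t * (?Z t)\<^sup>2" if "t \<in> cube I" for t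
  proof (rule mult_left_mono[OF _ kern_nonneg[OF s that]])
    have "0 \<le> (?Z t - m)\<^sup>2" by simp
    then show "2 * m * ?Z t - m\<^sup>2 \<le> (?Z t)\<^sup>2" by (simp add: power2_diff mult_ac)
  qed
  then have "(\<Sum>t\<in>cube I. kern I s t * (2 * m * ?Z t - m\<^sup>2))
      \<le> (\<Sum>t\<in>cube I. kern I s t * (?Z t)\<^sup>2)"
    by (rule sum_mono)
  also have "(\<Sum>t\<in>cube I. kern I s t * (2 * m * ?Z t - m\<^sup>2))
      = 2 * m * (\<Sum>t\<in>cube I. kern I s t * ?Z t) - m\<^sup>2 * (\<Sum>t\<in>cube I. kern I s t)"
    by (simp add: sum_distrib_left sum_subtractf algebra_simps)
  also have "\<dots> = 2 ^ card I * m\<^sup>2"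
    unfolding Z sum_kern[OF I s] by (simp add: power2_eq_square)
  finally show ?thesis by (simp add: m_def power_divide)
qed

section \<open>Multiplication by sign vectors\<close>

lemma cube_mult:
  assumes s: "s \<in> cube I" and h: "\<And>i. i \<in> I \<Longrightarrow> h i = -1 \<or> h i = 1"
  shows "(\<lambda>i\<in>I. s i * h i) \<in> cube I"
  unfolding cube_def
proof (rule restrict_PiE_iff[THEN iffD2], rule ballI)
  fix i assume "i \<in> I"
  then show "s i * h i \<in> {-1, 1}" using cube_cases[OF s, of i] h[of i] by auto
qed

text \<open>Multiplication by \<open>h\<close> is an involution of the cube.\<close>

lemma sum_cube_mult:
  assumes "\<And>i. i \<in> I \<Longrightarrow> h i = -1 \<or> h i = 1"
  shows "(\<Sum>s\<in>cube I. f (\<lambda>i\<in>I. s i * h i) s) = (\<Sum>s\<in>cube I. f s (\<lambda>i\<in>I. s i * h i))"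
proof (rule sum.reindex_bij_witness[where i = "\<lambda>s. \<lambda>i\<in>I. s i * h i" and j = "\<lambda>s. \<lambda>i\<in>I. s i * h i"])
  have inv: "(\<lambda>i\<in>I. (\<lambda>i\<in>I. s i * h i) i * h i) = s" if "s \<in> cube I" for s
  proof
    fix i show "(\<lambda>i\<in>I. (\<lambda>i\<in>I. s i * h i) i * h i) i = s i"
      using that assms[of i] by (auto simp: cube_def PiE_def extensional_def)
  qed
  fix s assume s: "s \<in> cube I"
  show "(\<lambda>i\<in>I. (\<lambda>i\<in>I. s i * h i) i * h i) = s" "(\<lambda>i\<in>I. (\<lambda>i\<in>I. s i * h i) i * h i) = s"
    "(\<lambda>i\<in>I. s i * h i) \<in> cube I" "(\<lambda>i\<in>I. s i * h i) \<in> cube I"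
    using inv[OF s] cube_mult[OF s assms] by auto
  show "f (\<lambda>i\<in>I. s i * h i) (\<lambda>i\<in>I. (\<lambda>i\<in>I. s i * h i) i * h i) = f (\<lambda>i\<in>I. s i * h i) s"
    using inv[OF s] by simp
qed

subsection \<open>Quantum families from real vectors\<close>

text \<open>Sylvester's doubling: the top bits of \<open>a\<close> and \<open>i\<close> select one
  of four blocks, of which only the last is negated.\<close>

fun hadamard :: "nat \<Rightarrow> nat \<Rightarrow> nat \<Rightarrow> real" where
  "hadamard 0 a i = 1"
| "hadamard (Suc k) a i =
    (if 2 ^ k \<le> a \<and> 2 ^ k \<le> i then -1 else 1) * hadamard k (a mod 2 ^ k) (i mod 2 ^ k)"

lemma hadamard_cases: "hadamard k a i = -1 \<or> hadamard k a i = 1"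
  by (induction k arbitrary: a i) auto

text \<open>The second half of the rows repeats the first up to the sign
  \<open>\<epsilon> i * \<epsilon> j\<close>, so the halves cancel if the top bits differ.
  Orthogonality of the columns makes the measurement operators sum to the identity.\<close>

lemma hadamard_orthogonal:
  assumes "i < 2 ^ k" "j < 2 ^ k"
  shows "(\<Sum>a<2 ^ k. hadamard k a i * hadamard k a j) = (if i = j then 2 ^ k else 0)"
  using assms
proof (induction k arbitrary: i j)
  case (Suc k)
  define \<epsilon> where "\<epsilon> i = (if 2 ^ k \<le> i then -1 else 1 :: real)" for i :: nat
  let ?S = "\<Sum>a<2 ^ k. hadamard k a (i mod 2 ^ k) * hadamard k a (j mod 2 ^ k)"
  have split: "(\<Sum>a<n + m. f a) = (\<Sum>a<n. f a) + (\<Sum>a<m. f (n + a))" for f :: "nat \<Rightarrow> real" and n m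
    by (induction m) (auto simp: add.assoc)
  have "(\<Sum>a<2 ^ Suc k. hadamard (Suc k) a i * hadamard (Suc k) a j) =
      (\<Sum>a<2 ^ k. hadamard k a (i mod 2 ^ k) * hadamard k a (j mod 2 ^ k)) +
      (\<Sum>a<2 ^ k. \<epsilon> i * \<epsilon> j * (hadamard k a (i mod 2 ^ k) * hadamard k a (j mod 2 ^ k)))"
    unfolding power_Suc mult_2 split
    by (intro arg_cong2[where f = "(+)"] sum.cong) (auto simp: \<epsilon>_def)
  also have "\<dots> = (1 + \<epsilon> i * \<epsilon> j) * ?S"
    by (simp add: distrib_right flip: sum_distrib_left)
  also have "?S = (if i mod 2 ^ k = j mod 2 ^ k then 2 ^ k else 0)"
    by (rule Suc.IH) simp_all
  also have "(1 + \<epsilon> i * \<epsilon> j) * \<dots> = (if i = j then 2 ^ Suc k else 0)"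
  proof -
    have "x mod 2 ^ k = (if 2 ^ k \<le> x then x - 2 ^ k else x)" if "x < 2 ^ Suc k" for x :: nat
      using that by (simp add: mod_if)
    then show ?thesis using Suc.prems by (auto simp: \<epsilon>_def)
  qed
  finally show ?case .
qed simp

text \<open>The quadratic form is a sum of squared moduli, one for each \<open>w l\<close>. All
  measurement operators and the state below have this form.\<close>

lemma psd_gram:
  fixes w :: "'l \<Rightarrow> nat \<Rightarrow> real"
  shows "psd d (mat d d (\<lambda>(i, j). complex_of_real (\<Sum>l\<in>L. w l i * w l j)))"
  unfolding psd_def
proof (intro conjI ballI)
  fix v :: "complex vec" assume v: "v \<in> carrier_vec d"
  let ?A = "mat d d (\<lambda>(i, j). complex_of_real (\<Sum>l\<in>L. w l i * w l j))"
  define z where "z l = (\<Sum>j<d. of_real (w l j) * v $ j)" for l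
  have "(?A *\<^sub>v v) \<bullet>c v = (\<Sum>i<d. (\<Sum>j<d. complex_of_real (\<Sum>l\<in>L. w l i * w l j) * v $ j) * cnj (v $ i))"
    using v by (simp add: scalar_prod_def lessThan_atLeast0)
  also have "\<dots> = (\<Sum>i<d. \<Sum>j<d. \<Sum>l\<in>L. (of_real (w l j) * v $ j) * cnj (of_real (w l i) * v $ i))"
    by (simp add: sum_distrib_right sum_distrib_left mult_ac)
  also have "\<dots> = (\<Sum>l\<in>L. \<Sum>i<d. \<Sum>j<d. (of_real (w l j) * v $ j) * cnj (of_real (w l i) * v $ i))"
    by (simp only: sum.swap[of _ L])
  also have "\<dots> = (\<Sum>l\<in>L. z l * cnj (z l))"
    unfolding z_def by (simp add: sum_product cnj_sum) (subst sum.swap, rule refl)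
  also have "\<dots> = of_real (\<Sum>l\<in>L. (cmod (z l))\<^sup>2)"
    by (simp only: of_real_sum complex_norm_square)
  also have "0 \<le> \<dots>" by (simp add: less_eq_complex_def sum_nonneg)
  finally show "0 \<le> (?A *\<^sub>v v) \<bullet>c v" .
qed simp

text \<open>
  Outcomes \<open>a < m\<close> project onto the vectors \<open>v a / sqrt m\<close> of \<open>\<complex>\<^sup>m \<subseteq> \<complex>\<^sup>n\<close>, outcome \<open>m\<close> projects onto
  the orthogonal complement of \<open>\<complex>\<^sup>m\<close>, and the remaining outcomes do not occur.
\<close>

definition meas_entry :: "nat \<Rightarrow> (nat \<Rightarrow> nat \<Rightarrow> real) \<Rightarrow> nat \<Rightarrow> nat \<Rightarrow> nat \<Rightarrow> real" where
  "meas_entry m v a i j =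
    (if a < m then if i < m \<and> j < m then v a i * v a j / m else 0
     else if a = m \<and> i = j \<and> m \<le> i then 1 else 0)"

lemma povm_meas_entry:
  assumes "0 < m" "m \<le> n"
    and v: "\<And>i j. i < m \<Longrightarrow> j < m \<Longrightarrow> (\<Sum>a<m. v a i * v a j) = (if i = j then real m else 0)"
  shows "povm n (n + 1) (\<lambda>a. mat n n (\<lambda>(i, j). complex_of_real (meas_entry m v a i j)))"
  unfolding povm_def
proof (intro conjI allI impI)
  fix a
  show "psd n (mat n n (\<lambda>(i, j). complex_of_real (meas_entry m v a i j)))"
  proof (cases "a < m")
    case True
    have "meas_entry m v a i j =
        (\<Sum>l\<in>{()}. (if i < m then v a i / sqrt m else 0) * (if j < m then v a j / sqrt m else 0))" for i j
      using True by (simp add: meas_entry_def)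
    then show ?thesis by (simp only: psd_gram)
  next
    case False
    \<comment> \<open>Outcome \<open>m\<close> sums over the basis vectors from \<open>m\<close> on;
      the empty index set gives the zero operator for later outcomes.\<close>
    have "meas_entry m v a i j =
        (\<Sum>l\<in>(if a = m then {m..<n} else {}). (if l = i then 1 else 0) * (if l = j then 1 else 0))"
      if "i < n" for i j
    proof -
      have *: "(\<lambda>l. (if l = i then 1 else 0) * (if l = j then 1 else 0)) =
          (\<lambda>l. if l = i then if i = j then 1 else 0 else (0 :: real))"
        by auto
      show ?thesis unfolding * using False that by (auto simp: meas_entry_def)
    qed
    then have "mat n n (\<lambda>(i, j). complex_of_real (meas_entry m v a i j)) =
        mat n n (\<lambda>(i, j). complex_of_real
          (\<Sum>l\<in>(if a = m then {m..<n} else {}). (if l = i then 1 else 0) * (if l = j then 1 else 0)))"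
      by (intro cong_mat) auto
    then show ?thesis by (simp only: psd_gram)
  qed
next
  have "(\<Sum>a<Suc n. meas_entry m v a i j) = (if i = j then 1 else 0)" if "i < n" "j < n" for i j
  proof -
    have "(\<Sum>a<Suc n. meas_entry m v a i j) = (\<Sum>a<Suc m. meas_entry m v a i j)"
      using assms by (intro sum.mono_neutral_right) (auto simp: meas_entry_def)
    also have "\<dots> = (\<Sum>a<m. if i < m \<and> j < m then v a i * v a j / m else 0)
        + (if i = j \<and> m \<le> i then 1 else 0)"
      by (simp add: meas_entry_def)
    also have "\<dots> = (if i = j then 1 else 0)"
      using v[of i j] \<open>0 < m\<close> by (cases "i < m \<and> j < m") (auto simp flip: sum_divide_distrib)
    finally show ?thesis .
  qed
  then show "mat n n (\<lambda>(i, j). \<Sum>a<n + 1.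
      mat n n (\<lambda>(i, j). complex_of_real (meas_entry m v a i j)) $$ (i, j)) = 1\<^sub>m n"
    by (intro eq_matI) (auto simp del: sum.lessThan_Suc simp flip: of_real_sum)
qed

text \<open>
  For real matrices \<open>E\<close> and \<open>F\<close>, the sum of the \<open>E\<^sub>i\<^sub>j * F\<^sub>i\<^sub>j / m\<close> is the expectation of \<open>E \<otimes> F\<close> in the
  maximally entangled state of \<open>\<complex>\<^sup>m \<otimes> \<complex>\<^sup>m\<close>.
\<close>

definition quantum_family :: "nat \<Rightarrow> (nat \<Rightarrow> nat \<Rightarrow> nat \<Rightarrow> real) \<Rightarrow> bell_family" where
  "quantum_family m v a b x y =
    (\<Sum>i<m. \<Sum>j<m. meas_entry m (v x) a i j * meas_entry m (v y) b i j) / m"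

lemma quantum_family:
  assumes m: "0 < m" "m \<le> n"
    and v: "\<And>x i j. i < m \<Longrightarrow> j < m \<Longrightarrow> (\<Sum>a<m. v x a i * v x a j) = (if i = j then real m else 0)"
  shows "quantum_family m v \<in> quantum n n N (n + 1)"
proof -
  \<comment> \<open>Index \<open>i * n + i\<close> belongs to the tensor square of basis vector
    \<open>i\<close>, so \<open>w\<close> is the maximally entangled unit vector on the first
    \<open>m\<close> of them and \<open>\<rho>\<close> the projection onto it.\<close>
  define D where "D = (\<lambda>i. i * n + i) ` {..<m}"
  define w where "w r = (if r \<in> D then 1 / sqrt m else 0)" for r
  define \<rho> where "\<rho> = mat (n * n) (n * n) (\<lambda>(r, c). complex_of_real (w r * w c))"
  define E where "E x a = mat n n (\<lambda>(i, j). complex_of_real (meas_entry m (v x) a i j))" for x a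
  have "i * n + i < n * n" if "i < m" for i
  proof -
    have "i * n + i < Suc i * n" using that m by simp
    also have "\<dots> \<le> n * n" using that m by (intro mult_right_mono) auto
    finally show ?thesis .
  qed
  then have D: "D \<subseteq> {..<n * n}" by (auto simp: D_def)
  have inj: "inj_on (\<lambda>i. i * n + i) {..<m}"
    by (rule inj_onI) (metis mult.commute mult_Suc_right mult_cancel_right nat.distinct(1) add.commute mult_Suc)
  have wD: "w (i * n + i) = 1 / sqrt m" if "i < m" for i
    using that by (auto simp: w_def D_def)
  have sumD: "(\<Sum>r<n * n. of_real (w r) * f r) = (\<Sum>i<m. f (i * n + i)) / of_real (sqrt m)"
    for f :: "nat \<Rightarrow> complex"
  proof -
    have "(\<Sum>r<n * n. of_real (w r) * f r) = (\<Sum>r\<in>D. of_real (w r) * f r)"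
      using D by (intro sum.mono_neutral_right) (auto simp: w_def)
    also have "\<dots> = (\<Sum>i<m. f (i * n + i) / of_real (sqrt m))"
      unfolding D_def by (subst sum.reindex[OF inj]) (simp add: wD)
    finally show ?thesis by (simp add: sum_divide_distrib)
  qed
  have sqrt: "complex_of_real (sqrt m) * complex_of_real (sqrt m) = of_nat m"
    by (simp flip: of_real_mult)
  have "psd (n * n) \<rho>"
    using psd_gram[of "n * n" "\<lambda>_. w" "{()}"] by (simp add: \<rho>_def)
  moreover have "mtrace \<rho> = 1"
  proof -
    have "mtrace \<rho> = (\<Sum>r<n * n. of_real (w r) * of_real (w r))"
      by (simp add: mtrace_def \<rho>_def)
    also have "\<dots> = of_nat m / (of_real (sqrt m) * of_real (sqrt m))"
      unfolding sumD by (simp add: wD)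
    also have "\<dots> = 1" using m by (simp only: sqrt) simp
    finally show ?thesis .
  qed
  ultimately have "density_operator (n * n) \<rho>" by (simp add: density_operator_def)
  moreover have "povm n (n + 1) (E x)" for x
    unfolding E_def by (rule povm_meas_entry[OF m v])
  moreover have "complex_of_real (quantum_family m v a b x y) = mtrace (tensor_mat (E x a) (E y b) * \<rho>)"
    for a b x y
  proof -
    have dims: "dim_row (E x a) = n" "dim_col (E x a) = n" for x a by (simp_all add: E_def)
    let ?T = "tensor_mat (E x a) (E y b)"
    have entry: "?T $$ (i * n + i, j * n + j) =
        complex_of_real (meas_entry m (v x) a i j * meas_entry m (v y) b i j)" if "i < m" "j < m" for i j
    proof -
      have "i * n + i < n * n" "j * n + j < n * n" using that D by (auto simp: D_def)
      then show ?thesis using that m by (simp add: tensor_mat_def dims) (simp add: E_def)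
    qed
    have "mtrace (?T * \<rho>) = (\<Sum>r<n * n. \<Sum>c<n * n. ?T $$ (r, c) * (of_real (w c) * of_real (w r)))"
      by (simp add: mtrace_def tensor_mat_def dims \<rho>_def scalar_prod_def lessThan_atLeast0)
    also have "\<dots> = (\<Sum>r<n * n. of_real (w r) * (\<Sum>c<n * n. of_real (w c) * ?T $$ (r, c)))"
      by (simp add: sum_distrib_left mult_ac)
    also have "\<dots> = (\<Sum>i<m. \<Sum>j<m. ?T $$ (i * n + i, j * n + j)) / of_nat m"
      unfolding sumD by (simp add: sqrt flip: sum_divide_distrib)
    also have "\<dots> = complex_of_real (quantum_family m v a b x y)"
      by (simp add: entry quantum_family_def)
    finally show ?thesis by simp
  qed
  ultimately show ?thesis unfolding quantum_def by blast
qed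

text \<open>Both operators have rank one, so the double sum is a square; each of them and the state
  contribute a factor \<open>1 / m\<close>.\<close>

lemma quantum_family_inner:
  assumes "0 < m" "a < m" "b < m"
  shows "quantum_family m v a b x y = (\<Sum>i<m. v x a i * v y b i)\<^sup>2 / m ^ 3"
proof -
  have "quantum_family m v a b x y =
      (\<Sum>i<m. \<Sum>j<m. (v x a i * v y b i) * (v x a j * v y b j) / (m * m)) / m"
    unfolding quantum_family_def meas_entry_def using assms
    by (intro arg_cong2[where f = "(/)"] sum.cong refl) auto
  then show ?thesis
    by (simp add: power2_eq_square power3_eq_cube sum_product flip: sum_divide_distrib)
qed

text \<open>Pointwise in \<open>\<omega>\<close> a classical family is a product of responses, so a
  bound for all products survives integration. Nonnegativity of \<open>M\<close> supplies the lower
  bound in the absolute value.\<close>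

lemma largest_violation_ge:
  assumes C: "0 < C"
    and M: "\<And>a b x y. 0 \<le> M a b x y"
    and bound: "\<And>p q. (\<And>x a. x < N \<Longrightarrow> a < K \<Longrightarrow> 0 \<le> p a x) \<Longrightarrow> (\<And>x. x < N \<Longrightarrow> (\<Sum>a<K. p a x) = 1) \<Longrightarrow>
      (\<And>x a. x < N \<Longrightarrow> a < K \<Longrightarrow> 0 \<le> q a x) \<Longrightarrow> (\<And>x. x < N \<Longrightarrow> (\<Sum>a<K. q a x) = 1) \<Longrightarrow>
      bell_pairing N K M (\<lambda>a b x y. p a x * q b y) \<le> C"
  shows "ereal (bell_pairing N K M P / C) \<le> largest_violation N K P"
proof -
  define M' where "M' a b x y = M a b x y / C" for a b x y
  have scale: "bell_pairing N K M' P' = bell_pairing N K M P' / C" for P'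
    by (simp add: bell_pairing_def M'_def sum_divide_distrib)
  have "\<bar>bell_pairing N K M' P'\<bar> \<le> 1" if "P' \<in> classical N K" for P'
  proof -
    obtain \<Omega> :: "(nat \<Rightarrow> real) measure" and p q where pr: "prob_space \<Omega>"
      and p: "response \<Omega> N K p" and q: "response \<Omega> N K q"
      and P': "\<And>x y a b. x < N \<Longrightarrow> y < N \<Longrightarrow> a < K \<Longrightarrow> b < K \<Longrightarrow>
        P' a b x y = (\<integral>\<omega>. p a x \<omega> * q b y \<omega> \<partial>\<Omega>)"
      using \<open>P' \<in> classical N K\<close> unfolding classical_def classical_over_def by blast
    interpret prob_space \<Omega> by (rule pr)
    have le1: "f a x \<omega> \<le> 1" if "response \<Omega> N K f" "x < N" "a < K" "\<omega> \<in> space \<Omega>" for f a x \<omega>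
    proof -
      have "f a x \<omega> \<le> (\<Sum>a<K. f a x \<omega>)"
        using that by (intro member_le_sum) (auto simp: response_def)
      then show ?thesis using that by (simp add: response_def)
    qed
    have int: "integrable \<Omega> (\<lambda>\<omega>. p a x \<omega> * q b y \<omega>)" if "x < N" "y < N" "a < K" "b < K" for a b x y
    proof (rule integrable_const_bound[where B = 1])
      show "AE \<omega> in \<Omega>. norm (p a x \<omega> * q b y \<omega>) \<le> 1"
      proof (rule AE_I2)
        fix \<omega> assume \<omega>: "\<omega> \<in> space \<Omega>"
        have "0 \<le> p a x \<omega>" "0 \<le> q b y \<omega>" using p q that \<omega> by (auto simp: response_def)
        then show "norm (p a x \<omega> * q b y \<omega>) \<le> 1"
          using le1[OF p, of x a \<omega>] le1[OF q, of y b \<omega>] that \<omega> by (simp add: mult_le_one abs_mult)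
      qed
      show "(\<lambda>\<omega>. p a x \<omega> * q b y \<omega>) \<in> borel_measurable \<Omega>"
        using p q that unfolding response_def by (intro borel_measurable_times) auto
    qed
    let ?f = "\<lambda>\<omega>. bell_pairing N K M (\<lambda>a b x y. p a x \<omega> * q b y \<omega>)"
    have "has_bochner_integral \<Omega> ?f (bell_pairing N K M P')"
      unfolding bell_pairing_def
    proof (intro has_bochner_integral_sum has_bochner_integral_mult_right)
      fix x y a b assume "x \<in> {..<N}" "y \<in> {..<N}" "a \<in> {..<K}" "b \<in> {..<K}"
      then show "has_bochner_integral \<Omega> (\<lambda>\<omega>. p a x \<omega> * q b y \<omega>) (P' a b x y)"
        by (simp add: has_bochner_integral_iff int P')
    qed
    then have intf: "integrable \<Omega> ?f" and "bell_pairing N K M P' = (\<integral>\<omega>. ?f \<omega> \<partial>\<Omega>)"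
      by (simp_all add: has_bochner_integral_iff)
    moreover have "(\<integral>\<omega>. ?f \<omega> \<partial>\<Omega>) \<le> C"
    proof (rule integral_le_const[OF intf], rule AE_I2)
      fix \<omega> assume "\<omega> \<in> space \<Omega>"
      then show "?f \<omega> \<le> C" using p q by (intro bound) (auto simp: response_def)
    qed
    moreover have "0 \<le> (\<integral>\<omega>. ?f \<omega> \<partial>\<Omega>)"
    proof (rule Bochner_Integration.integral_nonneg)
      fix \<omega> assume "\<omega> \<in> space \<Omega>"
      then show "0 \<le> ?f \<omega>" unfolding bell_pairing_def
        using p q M by (intro sum_nonneg mult_nonneg_nonneg) (auto simp: response_def)
    qed
    ultimately show ?thesis using C by (simp add: scale)
  qed
  then show ?thesis unfolding largest_violation_def scale[symmetric]
    by (intro SUP_upper) auto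
qed

text \<open>Outcomes are moved outside because the later substitution of inputs depends on
  them.\<close>

lemma bell_pairing_restrict:
  assumes "L \<le> N" "m \<le> K"
  shows "bell_pairing N K (\<lambda>a b x y. if x < L \<and> y < L \<and> a < m \<and> b < m then g a b x y else 0) P =
    (\<Sum>a<m. \<Sum>b<m. \<Sum>x<L. \<Sum>y<L. g a b x y * P a b x y)"
proof -
  let ?M = "\<lambda>a b x y. if x < L \<and> y < L \<and> a < m \<and> b < m then g a b x y else 0"
  have restr: "(\<Sum>i<n. f i) = (\<Sum>i<l. f i)" if "l \<le> n" "\<And>i. l \<le> i \<Longrightarrow> f i = 0"
    for l n :: nat and f :: "nat \<Rightarrow> real"
    using that by (intro sum.mono_neutral_right) auto
  have "bell_pairing N K ?M P = (\<Sum>x<L. \<Sum>y<L. \<Sum>a<m. \<Sum>b<m. ?M a b x y * P a b x y)"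
    unfolding bell_pairing_def
    by (simp add: restr[OF assms(1)] restr[OF assms(2)])
  also have "\<dots> = (\<Sum>x<L. \<Sum>y<L. \<Sum>a<m. \<Sum>b<m. g a b x y * P a b x y)"
    by (intro sum.cong) auto
  also have "\<dots> = (\<Sum>a<m. \<Sum>b<m. \<Sum>x<L. \<Sum>y<L. g a b x y * P a b x y)"
    by (simp only: sum.swap[of _ "{..<m}" "{..<L}"])
  finally show ?thesis .
qed

subsection \<open>The Bell functional\<close>

lemma violation_power_of_two:
  fixes k n N :: nat
  defines "m \<equiv> 2 ^ k"
  assumes mn: "m \<le> n" and N: "2 ^ m \<le> N"
  shows "\<exists>P \<in> quantum n n N (n + 1). ereal (sqrt m / 9) \<le> largest_violation N (n + 1) P"
proof -
  define I where "I = {..<m}"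
  define L where "L = (2 ^ m :: nat)"
  have I: "finite I" "card I = m" by (simp_all add: I_def)
  have m: "0 < m" by (simp add: m_def)
  obtain e where e: "bij_betw e {..<L} (cube I)"
    using finite_same_card_bij[of "{..<L}" "cube I"] I by (auto simp: finite_cube card_cube L_def)
  define d where "d = the_inv_into {..<L} e"
  have d: "d (e x) = x" if "x < L" for x
    using e that by (simp add: d_def bij_betw_def the_inv_into_f_f)
  have dL: "d s < L" if "s \<in> cube I" for s
    using bij_betwE[OF bij_betw_the_inv_into[OF e]] that by (auto simp: d_def)
  have e_cube: "e x \<in> cube I" if "x < L" for x
    using bij_betwE[OF e] that by auto
  have sum_e: "(\<Sum>x<L. f (e x) x) = (\<Sum>s\<in>cube I. f s (d s))" for f :: "_ \<Rightarrow> _ \<Rightarrow> real"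
  proof -
    have "(\<Sum>x<L. f (e x) x) = (\<Sum>x<L. (\<lambda>s. f s (d s)) (e x))" using d by simp
    also have "\<dots> = (\<Sum>s\<in>cube I. f s (d s))" by (rule sum.reindex_bij_betw[OF e])
    finally show ?thesis .
  qed
  \<comment> \<open>Reducing \<open>x mod L\<close> gives a valid measurement also to inputs from
    \<open>L\<close> on, where the functional vanishes.\<close>
  define v where "v x a i = e (x mod L) i * hadamard k a i" for x a i
  define h where "h a s = (\<lambda>i\<in>I. s i * hadamard k a i)" for a and s :: "nat \<Rightarrow> real"
  have vh: "kern I (v x a) (v y b) = kern I (h a (e x)) (h b (e y))" if "x < L" "y < L" for a b x y
    unfolding kern_def using that by (intro prod.cong) (auto simp: v_def h_def)
  have h_cube: "h a s \<in> cube I" if "s \<in> cube I" for a s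
    unfolding h_def using that hadamard_cases by (rule cube_mult)
  have sum_h: "(\<Sum>s\<in>cube I. f (h a s) s) = (\<Sum>s\<in>cube I. f s (h a s))" for f :: "_ \<Rightarrow> _ \<Rightarrow> real" and a
    unfolding h_def by (rule sum_cube_mult) (rule hadamard_cases)
  define g where "g a b x y = kern I (v x a) (v y b)" for a b x y
  define M where "M = (\<lambda>a b x y. if x < L \<and> y < L \<and> a < m \<and> b < m then g a b x y else 0)"
  have pairing: "bell_pairing N (n + 1) M P =
      (\<Sum>a<m. \<Sum>b<m. \<Sum>x<L. \<Sum>y<L. g a b x y * P a b x y)" for P
    unfolding M_def using N mn by (intro bell_pairing_restrict) (auto simp: L_def)
  \<comment> \<open>For fixed outcomes, substituting \<open>s = h a (e x)\<close> and
    \<open>t = h b (e y)\<close> makes the weight independent of \<open>a\<close> and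
    \<open>b\<close>. The four arguments of \<open>f\<close> serve the quantum summand, a function
    of \<open>s\<close> and \<open>t\<close>, and the classical one, a function of the
    inputs.\<close>
  have reindex: "(\<Sum>x<L. \<Sum>y<L. g a b x y * f (h a (e x)) x (h b (e y)) y) =
      (\<Sum>s\<in>cube I. \<Sum>t\<in>cube I. kern I s t * f s (d (h a s)) t (d (h b t)))"
    for a b and f :: "_ \<Rightarrow> _ \<Rightarrow> _ \<Rightarrow> _ \<Rightarrow> real"
  proof -
    have "(\<Sum>x<L. \<Sum>y<L. g a b x y * f (h a (e x)) x (h b (e y)) y) =
        (\<Sum>x<L. \<Sum>y<L. kern I (h a (e x)) (h b (e y)) * f (h a (e x)) x (h b (e y)) y)"
      by (intro sum.cong refl) (simp add: g_def vh)
    also have "\<dots> = (\<Sum>x<L. \<Sum>t\<in>cube I. kern I (h a (e x)) (h b t) * f (h a (e x)) x (h b t) (d t))"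
      by (intro sum.cong refl sum_e)
    also have "\<dots> = (\<Sum>x<L. \<Sum>t\<in>cube I. kern I (h a (e x)) t * f (h a (e x)) x t (d (h b t)))"
      by (intro sum.cong refl sum_h)
    also have "\<dots> = (\<Sum>s\<in>cube I. \<Sum>t\<in>cube I. kern I (h a s) t * f (h a s) (d s) t (d (h b t)))"
      by (rule sum_e)
    also have "\<dots> = (\<Sum>s\<in>cube I. \<Sum>t\<in>cube I. kern I s t * f s (d (h a s)) t (d (h b t)))"
      by (rule sum_h)
    finally show ?thesis .
  qed
  let ?C = "4 ^ m * sqrt m"
  let ?P = "quantum_family m v"
  have quantum: "?P \<in> quantum n n N (n + 1)"
  proof (rule quantum_family[OF m mn])
    fix x i j assume ij: "i < m" "j < m"
    have "e (x mod L) i * e (x mod L) i = 1"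
      using cube_cases[OF e_cube, of "x mod L" i] ij by (auto simp: L_def I_def)
    moreover have "(\<Sum>a<m. v x a i * v x a j) =
        e (x mod L) i * e (x mod L) j * (\<Sum>a<m. hadamard k a i * hadamard k a j)"
      by (simp add: v_def sum_distrib_left mult_ac)
    ultimately show "(\<Sum>a<m. v x a i * v x a j) = (if i = j then real m else 0)"
      using hadamard_orthogonal[of i k j] ij by (cases "i = j") (simp_all add: m_def)
  qed
  have "4 ^ m * m / 9 \<le> bell_pairing N (n + 1) M ?P"
  proof -
    have "4 ^ m * m / 9 = (\<Sum>a<m. \<Sum>b<m. \<Sum>s\<in>cube I. 2 ^ card I * (real (card I))\<^sup>2 / 9 / m ^ 3)"
      using m by (simp add: card_cube I field_simps power2_eq_square power3_eq_cube flip: power_mult_distrib)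
    also have "\<dots> \<le> (\<Sum>a<m. \<Sum>b<m. \<Sum>s\<in>cube I.
        (\<Sum>t\<in>cube I. kern I s t * (\<Sum>i\<in>I. s i * t i)\<^sup>2) / m ^ 3)"
      by (intro sum_mono divide_right_mono sum_kern_correlation_ge I) auto
    also have "\<dots> = (\<Sum>a<m. \<Sum>b<m. \<Sum>x<L. \<Sum>y<L.
        g a b x y * ((\<Sum>i\<in>I. h a (e x) i * h b (e y) i)\<^sup>2 / m ^ 3))"
      by (subst reindex) (simp add: sum_divide_distrib)
    also have "\<dots> = bell_pairing N (n + 1) M ?P"
      unfolding pairing using m
      by (intro sum.cong refl) (auto simp: quantum_family_inner h_def v_def I_def)
    finally show ?thesis .
  qed
  moreover have "ereal (bell_pairing N (n + 1) M ?P / ?C) \<le> largest_violation N (n + 1) ?P"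
  proof (rule largest_violation_ge)
    show "0 < ?C" using m by simp
    show "0 \<le> M a b x y" for a b x y
      by (auto simp: M_def g_def vh intro!: kern_nonneg h_cube e_cube)
    fix p q :: "nat \<Rightarrow> nat \<Rightarrow> real"
    assume p0: "\<And>x a. x < N \<Longrightarrow> a < n + 1 \<Longrightarrow> 0 \<le> p a x"
      and p1: "\<And>x. x < N \<Longrightarrow> (\<Sum>a<n + 1. p a x) = 1"
      and q0: "\<And>x a. x < N \<Longrightarrow> a < n + 1 \<Longrightarrow> 0 \<le> q a x"
      and q1: "\<And>x. x < N \<Longrightarrow> (\<Sum>a<n + 1. q a x) = 1"
    \<comment> \<open>\<open>A r s\<close> averages over \<open>a\<close> the probability of
      answering \<open>a\<close> on the input \<open>x\<close> with \<open>h a (e x) = s\<close>.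
      The value 0 off the cube is there because \<open>kern_sum_le\<close> asks for bounds at all
      \<open>s\<close>.\<close>
    define A where "A r s = (if s \<in> cube I then (\<Sum>a<m. r a (d (h a s))) / m else 0)"
      for r :: "nat \<Rightarrow> nat \<Rightarrow> real" and s
    have A: "(\<forall>s. 0 \<le> A r s \<and> A r s \<le> 1) \<and> (\<Sum>s\<in>cube I. A r s) \<le> 1 / m * 2 ^ card I"
      if r0: "\<And>x a. x < N \<Longrightarrow> a < n + 1 \<Longrightarrow> 0 \<le> r a x"
        and r1: "\<And>x. x < N \<Longrightarrow> (\<Sum>a<n + 1. r a x) = 1" for r :: "nat \<Rightarrow> nat \<Rightarrow> real"
    proof -
      have dN: "d s < N" if "s \<in> cube I" for s using dL[OF that] N by (simp add: L_def)
      have r_le: "r a x \<le> 1" if "a < m" "x < N" for a x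
        using member_le_sum[of a "{..<n + 1}" "\<lambda>a. r a x"] r0 r1[OF that(2)] that mn by simp
      have part: "(\<Sum>a<m. r a x) \<le> 1" if "x < N" for x
        unfolding r1[OF that, symmetric] using r0 that mn by (intro sum_mono2) auto
      have "0 \<le> A r s" for s
        unfolding A_def using r0 dN h_cube mn by (auto intro!: divide_nonneg_nonneg sum_nonneg)
      moreover have "A r s \<le> 1" for s
      proof (cases "s \<in> cube I")
        case True
        have "(\<Sum>a<m. r a (d (h a s))) \<le> (\<Sum>a<m. 1)"
          using r_le dN h_cube True by (intro sum_mono) auto
        then show ?thesis using m by (simp add: A_def)
      qed (simp add: A_def)
      moreover have "(\<Sum>s\<in>cube I. A r s) \<le> 1 / m * 2 ^ card I"
      proof -
        have "(\<Sum>s\<in>cube I. A r s) = (\<Sum>s\<in>cube I. \<Sum>a<m. r a (d (h a s))) / m"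
          by (simp add: A_def sum_divide_distrib)
        also have "(\<Sum>s\<in>cube I. \<Sum>a<m. r a (d (h a s))) = (\<Sum>a<m. \<Sum>s\<in>cube I. r a (d (h a s)))"
          by (rule sum.swap)
        \<comment> \<open>Undoing the twist for each \<open>a\<close> separately leaves, at each
          input, the total probability of the outcomes below \<open>m\<close>, which is at most
          1.\<close>
        also have "\<dots> = (\<Sum>a<m. \<Sum>s\<in>cube I. r a (d s))"
        proof (rule sum.cong[OF refl])
          show "(\<Sum>s\<in>cube I. r a (d (h a s))) = (\<Sum>s\<in>cube I. r a (d s))" for a
            by (rule sum_h[of "\<lambda>s _. r a (d s)"])
        qed
        also have "\<dots> = (\<Sum>s\<in>cube I. \<Sum>a<m. r a (d s))"
          by (rule sum.swap)
        also have "\<dots> \<le> (\<Sum>s\<in>cube I. 1)"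
          using part dN by (intro sum_mono) auto
        finally show ?thesis using m I by (simp add: card_cube divide_right_mono)
      qed
      ultimately show ?thesis by blast
    qed
    have "bell_pairing N (n + 1) M (\<lambda>a b x y. p a x * q b y) = (\<Sum>a<m. \<Sum>b<m.
        \<Sum>s\<in>cube I. \<Sum>t\<in>cube I. kern I s t * (p a (d (h a s)) * q b (d (h b t))))"
      unfolding pairing by (intro sum.cong refl) (rule reindex)
    also have "\<dots> = (\<Sum>s\<in>cube I. \<Sum>t\<in>cube I. \<Sum>a<m. \<Sum>b<m.
        kern I s t * (p a (d (h a s)) * q b (d (h b t))))"
      by (simp only: sum.swap[of _ "{..<m}" "cube I"])
    also have "\<dots> = (real m)\<^sup>2 * (\<Sum>s\<in>cube I. \<Sum>t\<in>cube I. kern I s t * A p s * A q t)"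
      unfolding sum_distrib_left
    proof (intro sum.cong refl)
      fix s t assume "s \<in> cube I" "t \<in> cube I"
      then show "(\<Sum>a<m. \<Sum>b<m. kern I s t * (p a (d (h a s)) * q b (d (h b t)))) =
          (real m)\<^sup>2 * (kern I s t * A p s * A q t)"
        using m by (simp add: A_def power2_eq_square sum_product flip: sum_distrib_left)
    qed
    also have "\<dots> \<le> (real m)\<^sup>2 * (4 ^ card I * (1 / m * sqrt (1 / m)))"
      using A[of p] A[of q] p0 p1 q0 q1 I by (intro mult_left_mono kern_sum_le) auto
    also have "\<dots> = ?C"
      using m I by (simp add: real_sqrt_divide power2_eq_square field_simps)
    finally show "bell_pairing N (n + 1) M (\<lambda>a b x y. p a x * q b y) \<le> ?C" .
  qed
  moreover have "sqrt m / 9 = 4 ^ m * m / 9 / ?C"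
    using m by (simp add: field_simps)
  ultimately have "ereal (sqrt m / 9) \<le> largest_violation N (n + 1) ?P"
    by (smt (verit) divide_right_mono ereal_less_eq(3) order_trans mult_nonneg_nonneg
        real_sqrt_ge_zero of_nat_0_le_iff zero_le_power)
  then show ?thesis using quantum by blast
qed

section \<open>The single-input case and the final constants\<close>

lemma violation_one_dimensional:
  "\<exists>P \<in> quantum 1 1 1 2. 1 \<le> largest_violation 1 2 P"
proof -
  let ?v = "\<lambda>_ _ _. 1 :: real"
  let ?M = "\<lambda>a b _ _. if a = 0 \<and> b = 0 then 1 else 0 :: real"
  have less2: "{..<2 :: nat} = {0, 1}" by auto
  have "quantum_family 1 ?v \<in> quantum 1 1 1 (1 + 1)"
    by (rule quantum_family) auto
  moreover have "ereal (bell_pairing 1 2 ?M (quantum_family 1 ?v) / 1) \<le> largest_violation 1 2 (quantum_family 1 ?v)"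
  proof (rule largest_violation_ge)
    fix p q :: "nat \<Rightarrow> nat \<Rightarrow> real"
    assume p: "\<And>x a. x < 1 \<Longrightarrow> a < 2 \<Longrightarrow> 0 \<le> p a x" "\<And>x. x < 1 \<Longrightarrow> (\<Sum>a<2. p a x) = 1"
      and q: "\<And>x a. x < 1 \<Longrightarrow> a < 2 \<Longrightarrow> 0 \<le> q a x" "\<And>x. x < 1 \<Longrightarrow> (\<Sum>a<2. q a x) = 1"
    have "0 \<le> p 0 0" "p 0 0 \<le> 1" "0 \<le> q 0 0" "q 0 0 \<le> 1"
      using p(1)[of 0 0] p(1)[of 0 1] p(2)[of 0] q(1)[of 0 0] q(1)[of 0 1] q(2)[of 0]
      by (simp_all add: less2)
    then show "bell_pairing 1 2 ?M (\<lambda>a b x y. p a x * q b y) \<le> 1"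
      by (simp add: bell_pairing_def less2 mult_le_one)
  qed auto
  moreover have "bell_pairing 1 2 ?M (quantum_family 1 ?v) = 1"
    by (simp add: bell_pairing_def less2 quantum_family_inner)
  ultimately show ?thesis by (auto simp: one_ereal_def numeral_2_eq_2)
qed

theorem theorem1:
  shows "\<exists>(c::real) (D :: real \<Rightarrow> real). c > 0 \<and> (\<forall>q>2. D q > 0) \<and>
    (\<forall>(n::nat) (q::real). n \<ge> 1 \<longrightarrow> q > 2 \<longrightarrow>
      (\<exists>P. P \<in> quantum n n ((nat \<lceil>real n powr (q / 2)\<rceil>) ^ n) (n + 1) \<and>
         largest_violation ((nat \<lceil>real n powr (q / 2)\<rceil>) ^ n) (n + 1) P
           \<ge> ereal (c * D q * real n powr (1 / 2 - 2 / q))))"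
proof (intro exI[of _ "1 / 18"] exI[of _ "\<lambda>_. 1"] conjI allI impI)
  fix n :: nat and q :: real
  assume n: "1 \<le> n" and q: "2 < q"
  let ?N = "(nat \<lceil>real n powr (q / 2)\<rceil>) ^ n"
  let ?r = "1 / 18 * 1 * real n powr (1 / 2 - 2 / q)"
  show "\<exists>P. P \<in> quantum n n ?N (n + 1) \<and> largest_violation ?N (n + 1) P \<ge> ereal ?r"
  proof (cases "n = 1")
    case True
    obtain P where Q: "P \<in> quantum 1 1 1 2" and P: "1 \<le> largest_violation 1 2 P"
      using violation_one_dimensional by blast
    have "ereal (1 / 18) \<le> largest_violation 1 2 P"
      by (rule order_trans[OF _ P]) (simp add: one_ereal_def)
    then show ?thesis
      using Q True by (intro exI[of _ P]) (simp add: numeral_2_eq_2)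
  next
    case False
    then have n2: "2 \<le> n" using n by simp
    obtain k where k: "2 ^ k \<le> n" "n < 2 ^ (k + 1)"
      using ex_power_ivl1[of 2 n] n by auto
    \<comment> \<open>Since \<open>q / 2 > 1\<close>, the base is at least \<open>n\<close>, so
      there are at least \<open>2 ^ n\<close> inputs.\<close>
    have "real n \<le> real n powr (q / 2)"
      using powr_mono[of 1 "q / 2" "real n"] q n by simp
    then have "n \<le> nat \<lceil>real n powr (q / 2)\<rceil>"
      by linarith
    then have "2 ^ n \<le> ?N" using n2 by (intro power_mono) auto
    moreover have "2 ^ 2 ^ k \<le> (2 ^ n :: nat)" using k by (intro power_increasing) auto
    ultimately have "2 ^ 2 ^ k \<le> ?N" by (rule order_trans[rotated])
    then obtain P where P: "P \<in> quantum n n ?N (n + 1)"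
      "ereal (sqrt (2 ^ k) / 9) \<le> largest_violation ?N (n + 1) P"
      using violation_power_of_two[of k n ?N] k by auto
    \<comment> \<open>Raising the exponent to \<open>1 / 2\<close> removes \<open>q\<close>, which
      is why \<open>D\<close> can be constant.\<close>
    have "real n powr (1 / 2 - 2 / q) \<le> real n powr (1 / 2)"
      using n q by (intro powr_mono) auto
    also have "\<dots> = sqrt n" using n by (simp add: powr_half_sqrt)
    \<comment> \<open>By the choice of \<open>k\<close>, \<open>n\<close> is below twice
      \<open>2 ^ k\<close>; rounding 2 up to 4 makes the extra factor of the root equal to 2, which
      turns \<open>1 / 9\<close> into \<open>1 / 18\<close>.\<close>
    also have "\<dots> \<le> sqrt (4 * 2 ^ k)"
    proof (rule real_sqrt_le_mono)
      have "real n < real (2 ^ (k + 1))" using k by (simp only: of_nat_less_iff)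
      then show "real n \<le> 4 * 2 ^ k" by simp
    qed
    also have "\<dots> = 2 * sqrt (2 ^ k)" by (simp add: real_sqrt_mult)
    finally have "ereal ?r \<le> ereal (sqrt (2 ^ k) / 9)" by simp
    then show ?thesis using P order_trans by blast
  qed
qed auto

end
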